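(* Let $Z=(Y,X)\in RV_1([0,\infty)\times\mathbb R^d,\{a_n=n\},c_Z,\tau,\sigma)$ with discrete angular measure $$\sigma(d\theta)=\frac1{c_Z}\sum_{i=1}^p\tau(c_i)\,\delta_{c_i/\tau(c_i)}(d\theta),\qquad c_i=(b_i,a_i),\quad c_Z=\sum_{i=1}^p\tau(c_i),$$ where $\tau(y,x)=y_++\|x\|$, $b_i\ge0$, $a_i\in\mathbb R^d$, not all $b_i$ are zero and not all $a_i$ are zero, and the dimension of the predictor $X$ is $d\ge2$. Suppose that: 1. $a_i\ne0$, $i=1,\dots,r$, for some $r\le p$, and $a_i=0$, $i=r+1,\dots,p$, if $r<p$; 2. $a_i/\|a_i\|\ne a_j/\|a_j\|$ for all $1\le i\ne j\le r$. Then: (i) The optimal homogeneous extremal precision is $$\lambda^{(\mathrm{opt})}_{\mathcal G}(Y,X)=\frac{\sum_{i=1}^rb_i}{\sum_{i=1}^pb_i}.$$ (ii) If $\lambda^{(\mathrm{opt})}_{\mathcal G}(Y,X)>0$, i.e. $\sum_{i=1}^rb_i>0$, then $\lambda^{(\mathrm{opt})}_{\mathcal G}(Y,X)=\lambda(Y,h^{(\mathrm{opt})}(X))$, where an optimal (oracle) predictor $h^{(\mathrm{opt})}:\mathbb R^d\to[0,\infty)$ is a continuous, non-negative, $1$-homogeneous function such that $$h^{(\mathrm{opt})}(a_i)=(1+\delta_r)\,b_i,\quad i=1,\dots,r,\qquad\text{where }1+\delta_r=\sum_{i=1}^pb_i\Big/\sum_{i=1}^rb_i.$$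
   Context: $\|\cdot\|$ is a fixed norm on $\mathbb R^d$, $y_+=\max\{0,y\}$; terms with $c_i=0$ in $\sigma$ are zero. The notation $Z\in RV_1([0,\infty)\times\mathbb R^d,\{n\},c_Z,\tau,\sigma)$ means: $n\mathbb P[\tau(Z)>tn]\to c_Zt^{-1}$ for all $t>0$, and the conditional law of $Z/\tau(Z)$ given $\tau(Z)>r$ converges weakly, as $r\to\infty$, to the probability measure $\sigma$ on $\{\tau=1\}$. (An example is $Y=\sum_{i=1}^pb_i\xi_i$, $X=\sum_{i=1}^pa_i\xi_i$ with iid standard $1$-Pareto $\xi_i$.) $1$-homogeneous: $h(cx)=ch(x)$ for $c\ge0$. $h(X)$ is asymptotically calibrated for $Y$ if $\mathbb P[h(X)>t]\sim\mathbb P[Y>t]$ as $t\to\infty$. $\lambda_p(Y,h(X))=\mathbb P[Y>F_Y^\leftarrow(p)\mid h(X)>F_{h(X)}^\leftarrow(p)]$ ($F^\leftarrow$ the left-continuous generalized inverse of the cdf); $\lambda(Y,h(X))=\lim_{p\uparrow1}\lambda_p(Y,h(X))$. $\mathcal G$ is the class of continuous, non-negative, $1$-homogeneous $g:\mathbb R^d\to[0,\infty)$ that are asymptotically calibrated for $Y$, and $\lambda^{(\mathrm{opt})}_{\mathcal G}(Y,X)=\sup_{g\in\mathcal G}\limsup_{p\uparrow1}\lambda_p(Y,g(X))$. *)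

theory Defs
  imports "HOL-Probability.Probability" "HOL-Library.Landau_Symbols"
begin

text \<open>The norm on \<open>\<real>\<^sup>d\<close> is arbitrary, hence an explicit function and not the Euclidean norm of
  the type class. Nonnegativity follows from the three axioms.\<close>

definition is_norm :: "('a::real_vector \<Rightarrow> real) \<Rightarrow> bool" where
  "is_norm N \<longleftrightarrow>
     (\<forall>x. N x = 0 \<longleftrightarrow> x = 0) \<and>
     (\<forall>c x. N (c *\<^sub>R x) = \<bar>c\<bar> * N x) \<and>
     (\<forall>x y. N (x + y) \<le> N x + N y)"

definition modulus :: "('a::real_vector \<Rightarrow> real) \<Rightarrow> real \<times> 'a \<Rightarrow> real" where
  "modulus N z = max 0 (fst z) + N (snd z)"

definition homogeneous1 :: "('a::real_vector \<Rightarrow> real) \<Rightarrow> bool" where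
  "homogeneous1 h \<longleftrightarrow> (\<forall>c\<ge>0. \<forall>x. h (c *\<^sub>R x) = c * h x)"

text \<open>Weak convergence along a filter; the library's \<open>weak_conv\<close> covers only sequences of
  distributions on the real line.\<close>

definition weakly_converges ::
  "('i \<Rightarrow> 'a::topological_space measure) \<Rightarrow> 'a measure \<Rightarrow> 'i filter \<Rightarrow> bool" where
  "weakly_converges \<mu> \<nu> F \<longleftrightarrow>
     (\<forall>f :: 'a \<Rightarrow> real. continuous_on UNIV f \<longrightarrow> bounded (range f) \<longrightarrow>
        ((\<lambda>i. integral\<^sup>L (\<mu> i) f) \<longlongrightarrow> integral\<^sup>L \<nu> f) F)"

text \<open>\<open>RV1 M Z E s c \<tau> \<sigma>\<close> renders \<open>Z \<in> RV\<^sub>1(E, {s\<^sub>n}, c, \<tau>, \<sigma>)\<close> for a random vector \<open>Z\<close> on \<open>M\<close>.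
  The measure \<open>uniform_measure M A\<close> is \<open>M\<close> conditioned on the event \<open>A\<close>. The angular laws are
  regarded as measures on the ambient space; for \<open>E\<close> and \<open>\<tau>\<close> such that \<open>E \<inter> {\<tau> = 1}\<close> is closed,
  weak convergence there agrees with weak convergence on \<open>E \<inter> {\<tau> = 1}\<close>.\<close>

definition RV1 ::
  "'w measure \<Rightarrow> ('w \<Rightarrow> 'a::real_normed_vector) \<Rightarrow> 'a set \<Rightarrow> (nat \<Rightarrow> real) \<Rightarrow> real \<Rightarrow>
   ('a \<Rightarrow> real) \<Rightarrow> 'a measure \<Rightarrow> bool" where
  "RV1 M Z E s c \<tau> \<sigma> \<longleftrightarrow>
     Z \<in> borel_measurable M \<and> (\<forall>\<omega>\<in>space M. Z \<omega> \<in> E) \<and>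
     prob_space \<sigma> \<and> sets \<sigma> = sets borel \<and> (AE z in \<sigma>. z \<in> E \<and> \<tau> z = 1) \<and>
     (\<forall>t>0. (\<lambda>n. real n * \<P>(\<omega> in M. \<tau> (Z \<omega>) > t * s n)) \<longlonglongrightarrow> c / t) \<and>
     weakly_converges
       (\<lambda>r. distr (uniform_measure M {\<omega> \<in> space M. \<tau> (Z \<omega>) > r}) borel
              (\<lambda>\<omega>. Z \<omega> /\<^sub>R \<tau> (Z \<omega>)))
       \<sigma> at_top"

text \<open>The measure \<open>(\<Sum>i. \<tau> c\<^sub>i \<cdot> \<delta>(c\<^sub>i / \<tau> c\<^sub>i)) / (\<Sum>i. \<tau> c\<^sub>i)\<close>, as the image under \<open>i \<mapsto> c\<^sub>i / \<tau> c\<^sub>i\<close> of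
  the weights on \<open>{1..p}\<close>. Indices with \<open>\<tau> c\<^sub>i = 0\<close> have weight zero.\<close>

definition discrete_angular_measure ::
  "('a::real_normed_vector \<Rightarrow> real) \<Rightarrow> nat \<Rightarrow> (nat \<Rightarrow> 'a) \<Rightarrow> 'a measure" where
  "discrete_angular_measure \<tau> p c =
     distr (point_measure {1..p} (\<lambda>i. ennreal (\<tau> (c i) / (\<Sum>j=1..p. \<tau> (c j)))))
       borel (\<lambda>i. c i /\<^sub>R \<tau> (c i))"

lemma emeasure_discrete_angular_measure:
  assumes "A \<in> sets borel"
  shows "emeasure (discrete_angular_measure \<tau> p c) A =
    (\<Sum>i=1..p. ennreal (\<tau> (c i) / (\<Sum>j=1..p. \<tau> (c j))) *
       emeasure (return borel (c i /\<^sub>R \<tau> (c i))) A)"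
proof -
  let ?w = "\<lambda>i. ennreal (\<tau> (c i) / (\<Sum>j=1..p. \<tau> (c j)))"
  let ?f = "\<lambda>i. c i /\<^sub>R \<tau> (c i)"
  have "emeasure (discrete_angular_measure \<tau> p c) A =
      emeasure (point_measure {1..p} ?w) (?f -` A \<inter> {1..p})"
    unfolding discrete_angular_measure_def using assms
    by (subst emeasure_distr) (auto simp: space_point_measure)
  also have "\<dots> = (\<Sum>i\<in>?f -` A \<inter> {1..p}. ?w i)"
    by (rule emeasure_point_measure_finite) auto
  also have "\<dots> = (\<Sum>i=1..p. ?w i * indicator A (?f i))"
    by (rule sum.mono_neutral_cong_left) (auto simp: indicator_def)
  finally show ?thesis using assms by simp
qed

text \<open>The left-continuous generalized inverse of the distribution function of \<open>W\<close>; it is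
  meaningful for \<open>0 < p < 1\<close>, where the set below is nonempty and bounded from below.\<close>

definition quantile :: "'w measure \<Rightarrow> ('w \<Rightarrow> real) \<Rightarrow> real \<Rightarrow> real" where
  "quantile M W p = Inf {x. p \<le> cdf (distr M borel W) x}"

definition precision :: "'w measure \<Rightarrow> ('w \<Rightarrow> real) \<Rightarrow> ('w \<Rightarrow> real) \<Rightarrow> real \<Rightarrow> real" where
  "precision M Y W p = \<P>(\<omega> in M. Y \<omega> > quantile M Y p \<bar> W \<omega> > quantile M W p)"

definition asymptotically_calibrated :: "'w measure \<Rightarrow> ('w \<Rightarrow> real) \<Rightarrow> ('w \<Rightarrow> real) \<Rightarrow> bool" where
  "asymptotically_calibrated M Y W \<longleftrightarrow>
     (\<lambda>t. \<P>(\<omega> in M. W \<omega> > t)) \<sim>[at_top] (\<lambda>t. \<P>(\<omega> in M. Y \<omega> > t))"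

definition predictors ::
  "'w measure \<Rightarrow> ('w \<Rightarrow> real) \<Rightarrow> ('w \<Rightarrow> 'a::real_normed_vector) \<Rightarrow> ('a \<Rightarrow> real) set" where
  "predictors M Y X = {g. continuous_on UNIV g \<and> (\<forall>x. 0 \<le> g x) \<and> homogeneous1 g \<and>
     asymptotically_calibrated M Y (\<lambda>\<omega>. g (X \<omega>))}"

definition optimal_precision ::
  "'w measure \<Rightarrow> ('w \<Rightarrow> real) \<Rightarrow> ('w \<Rightarrow> 'a::real_normed_vector) \<Rightarrow> ereal" where
  "optimal_precision M Y X =
     (SUP g\<in>predictors M Y X. Limsup (at_left 1) (\<lambda>p. ereal (precision M Y (\<lambda>\<omega>. g (X \<omega>)) p)))"

text \<open>The quotient of sums below is the factor \<open>1 + \<delta>\<^sub>r\<close>, which restores calibration of \<open>h\<close>.\<close>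

definition oracle_predictor ::
  "nat \<Rightarrow> nat \<Rightarrow> (nat \<Rightarrow> real) \<Rightarrow> (nat \<Rightarrow> 'a::real_normed_vector) \<Rightarrow> ('a \<Rightarrow> real) \<Rightarrow> bool" where
  "oracle_predictor p r b a h \<longleftrightarrow>
     continuous_on UNIV h \<and> (\<forall>x. 0 \<le> h x) \<and> homogeneous1 h \<and>
     (\<forall>i\<in>{1..r}. h (a i) = (\<Sum>j=1..p. b j) / (\<Sum>j=1..r. b j) * b i)"

end

theory Submission
  imports Defs "HOL-Real_Asymp.Real_Asymp"
begin

text \<open>For a continuous, non-negative, 1-homogeneous \<open>f\<close> bounded by a multiple of \<open>\<tau>\<close>, splitting the
  range of the angular factor into small pieces by tent functions shows that
  \<open>t P[f(Z) > t]\<close> tends to \<open>c \<integral> f d\<sigma>\<close>, which is \<open>\<Sum> f(b\<^sub>i, a\<^sub>i)\<close> for the discrete angular measure.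
  With \<open>f(y, x) = y\<close>, \<open>g(x)\<close> and \<open>min y (g x)\<close> this says that \<open>g\<close> is calibrated iff
  \<open>\<Sum> g(a\<^sub>i) = \<Sum> b\<^sub>i\<close>, and that its precision then tends to \<open>\<Sum> min (b\<^sub>i) (g(a\<^sub>i)) / \<Sum> b\<^sub>i\<close>. Since
  \<open>g 0 = 0\<close>, only the indices \<open>i \<le> r\<close> contribute, so the limit is at most \<open>\<Sum>\<^bsub>i\<le>r\<^esub> b\<^sub>i / \<Sum> b\<^sub>i\<close>, with
  equality when \<open>g(a\<^sub>i) \<ge> b\<^sub>i\<close> for all \<open>i \<le> r\<close>. If these \<open>b\<^sub>i\<close> all vanish, every
  limit is 0, and a multiple of the norm shows that the supremum is not over the empty set.\<close>

section \<open>Auxiliary limits, conditional expectations and tent functions\<close>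

text \<open>Regular variation is given along the integers only. With \<open>n\<close> the integer
  part of \<open>x\<close>, monotonicity squeezes \<open>x * G x\<close> between
  \<open>n * G (n + 1)\<close> and \<open>(n + 1) * G n\<close>, and both have the limit
  \<open>c\<close>.\<close>

lemma tendsto_tail_at_top:
  fixes G :: "real \<Rightarrow> real"
  assumes "antimono G" and "\<And>x. 0 \<le> G x"
    and lim: "(\<lambda>n. real n * G (real n)) \<longlonglongrightarrow> c"
  shows "((\<lambda>x. x * G x) \<longlongrightarrow> c) at_top"
proof -
  \<comment> \<open>The factors \<open>n / Suc n\<close> and \<open>Suc n / n\<close> tend to 1 and
    turn the given products into the shifted ones of the squeeze.\<close>
  have 1: "(\<lambda>n. (real n / real (Suc n)) * (real (Suc n) * G (real (Suc n)))) \<longlonglongrightarrow> 1 * c"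
    by (intro tendsto_mult LIMSEQ_Suc[OF lim] LIMSEQ_n_over_Suc_n)
  have 2: "(\<lambda>n. (real (Suc n) / real n) * (real n * G (real n))) \<longlonglongrightarrow> 1 * c"
    by (intro tendsto_mult lim LIMSEQ_Suc_n_over_n)
  have nf: "filterlim (\<lambda>x::real. nat \<lfloor>x\<rfloor>) sequentially at_top"
    by (intro filterlim_compose[OF filterlim_nat_sequentially] filterlim_floor_sequentially)
  have bounds: "real (nat \<lfloor>x\<rfloor>) * G (real (Suc (nat \<lfloor>x\<rfloor>))) \<le> x * G x
      \<and> x * G x \<le> real (Suc (nat \<lfloor>x\<rfloor>)) * G (real (nat \<lfloor>x\<rfloor>))" if "1 \<le> x" for x
  proof -
    have "real (nat \<lfloor>x\<rfloor>) \<le> x" "x \<le> real (Suc (nat \<lfloor>x\<rfloor>))"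
      using that by linarith+
    with assms(2) show ?thesis
      using that by (intro conjI mult_mono antimonoD[OF \<open>antimono G\<close>]) auto
  qed
  have ev: "eventually (\<lambda>x::real. 1 \<le> x) at_top" by (rule eventually_ge_at_top)
  show ?thesis
  proof (rule tendsto_sandwich)
    show "((\<lambda>x::real. real (nat \<lfloor>x\<rfloor>) * G (real (Suc (nat \<lfloor>x\<rfloor>)))) \<longlongrightarrow> c) at_top"
      using filterlim_compose[OF 1 nf] by (simp del: of_nat_Suc add: divide_simps)
    have "((\<lambda>x::real. (real (Suc (nat \<lfloor>x\<rfloor>)) / real (nat \<lfloor>x\<rfloor>)) * (real (nat \<lfloor>x\<rfloor>) * G (real (nat \<lfloor>x\<rfloor>)))) \<longlongrightarrow> c) at_top"
      using filterlim_compose[OF 2 nf] by simp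
    then show "((\<lambda>x::real. real (Suc (nat \<lfloor>x\<rfloor>)) * G (real (nat \<lfloor>x\<rfloor>))) \<longlongrightarrow> c) at_top"
      by (rule Lim_transform_eventually)
        (rule eventually_mono[OF ev], auto simp: floor_eq_iff)
  qed (rule eventually_mono[OF ev], use bounds in blast)+
qed

lemma (in prob_space) tail_prob_antimono:
  assumes [measurable]: "W \<in> borel_measurable M"
  shows "antimono (\<lambda>x. \<P>(\<omega> in M. W \<omega> > (x::real)))"
  by (intro antimonoI finite_measure_mono) auto

text \<open>The product form also covers a null event \<open>A\<close>, where both sides are
  0.\<close>

lemma (in prob_space) expectation_uniform_measure:
  assumes [measurable]: "A \<in> sets M" "f \<in> borel_measurable M"
  shows "prob A * (\<integral>\<omega>. f \<omega> \<partial>uniform_measure M A) = expectation (\<lambda>\<omega>. indicator A \<omega> * f \<omega> :: real)"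
proof (cases "prob A = 0")
  case True
  then have "emeasure M A = 0" by (simp add: emeasure_eq_measure)
  then have "AE \<omega> in M. indicator A \<omega> * f \<omega> = 0"
    by (intro AE_I[of _ _ A]) (auto simp: indicator_def)
  then have "expectation (\<lambda>\<omega>. indicator A \<omega> * f \<omega>) = 0" by (rule integral_eq_zero_AE)
  with True show ?thesis by simp
next
  case False
  have "uniform_measure M A = density M (\<lambda>\<omega>. ennreal (indicator A \<omega> / prob A))"
    unfolding uniform_measure_def using False
    by (intro arg_cong[where f="density M"])
      (auto simp: emeasure_eq_measure fun_eq_iff indicator_def zero_less_measure_iff divide_ennreal
         simp flip: ennreal_1)
  then have "(\<integral>\<omega>. f \<omega> \<partial>uniform_measure M A) = expectation (\<lambda>\<omega>. indicator A \<omega> * f \<omega> / prob A)"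
    by (simp add: integral_density)
  then show ?thesis using False by simp
qed

text \<open>The tents centred at \<open>0, ..., m\<close> are a partition of unity on the interval
  from \<open>0\<close> to \<open>m\<close>; the falling edge between \<open>m\<close> and
  \<open>m + 1\<close> is included because the induction needs it.\<close>

lemma sum_tents:
  fixes x :: real
  assumes "0 \<le> x"
  shows "(\<Sum>k\<le>m. max 0 (1 - \<bar>x - real k\<bar>)) = max 0 (min 1 (real m + 1 - x))"
proof (induction m)
  case 0
  then show ?case using assms by (simp add: max_def min_def)
next
  case (Suc m)
  show ?case unfolding sum.atMost_Suc Suc.IH of_nat_Suc by (simp add: max_def min_def)
qed

section \<open>Tails of homogeneous functions of a regularly varying vector\<close>

text \<open>For \<open>u = 1\<close> the expectation is the radial tail probability times the
  conditional mean of \<open>\<phi>\<close> at the angle; the first factor is of order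
  \<open>c / r\<close>, and weak convergence handles the second. Rescaling the threshold to
  \<open>r / u\<close> produces the factor \<open>u\<close>.\<close>

lemma (in prob_space) tendsto_angular_expectation:
  fixes Z :: "'a \<Rightarrow> 'b::{real_normed_vector, second_countable_topology}" and \<phi> :: "'b \<Rightarrow> real"
  assumes RV: "RV1 M Z E (\<lambda>n. real n) c \<tau> \<sigma>"
    and \<tau>: "continuous_on UNIV \<tau>"
    and \<phi>: "continuous_on UNIV \<phi>" "bounded (range \<phi>)"
    and u: "0 \<le> u"
  shows "((\<lambda>r. r * expectation (\<lambda>\<omega>. indicator {\<omega>\<in>space M. u * \<tau> (Z \<omega>) > r} \<omega> *
            \<phi> (Z \<omega> /\<^sub>R \<tau> (Z \<omega>)))) \<longlongrightarrow> c * u * integral\<^sup>L \<sigma> \<phi>) at_top"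
proof -
  have [measurable]: "Z \<in> borel_measurable M" "\<tau> \<in> borel_measurable borel" "\<phi> \<in> borel_measurable borel"
    using RV \<tau> \<phi> by (auto simp: RV1_def intro: borel_measurable_continuous_onI)
  let ?\<Theta> = "\<lambda>\<omega>. Z \<omega> /\<^sub>R \<tau> (Z \<omega>)"
  let ?A = "\<lambda>r. {\<omega>\<in>space M. \<tau> (Z \<omega>) > r}"
  have "(\<lambda>n. real n * prob (?A (real n))) \<longlonglongrightarrow> c"
    using RV unfolding RV1_def by (auto dest: spec[of _ 1])
  then have radial: "((\<lambda>r. r * prob (?A r)) \<longlongrightarrow> c) at_top"
    by (intro tendsto_tail_at_top tail_prob_antimono) auto
  have "((\<lambda>r. integral\<^sup>L (distr (uniform_measure M (?A r)) borel ?\<Theta>) \<phi>) \<longlongrightarrow> integral\<^sup>L \<sigma> \<phi>) at_top"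
    using RV \<phi> unfolding RV1_def weakly_converges_def by blast
  from tendsto_mult[OF radial this]
  have "((\<lambda>r. r * (prob (?A r) * integral\<^sup>L (uniform_measure M (?A r)) (\<lambda>\<omega>. \<phi> (?\<Theta> \<omega>)))) \<longlongrightarrow>
      c * integral\<^sup>L \<sigma> \<phi>) at_top"
    by (simp add: integral_distr mult.assoc)
  then have lim1: "((\<lambda>r. r * expectation (\<lambda>\<omega>. indicator (?A r) \<omega> * \<phi> (?\<Theta> \<omega>))) \<longlongrightarrow>
      c * integral\<^sup>L \<sigma> \<phi>) at_top"
    by (subst (asm) expectation_uniform_measure) auto
  show ?thesis
  proof (cases "u = 0")
    case True
    \<comment> \<open>For \<open>u = 0\<close> the event is \<open>0 > r\<close>, which is empty
      once \<open>r\<close> is nonnegative.\<close>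
    have "\<forall>\<^sub>F r::real in at_top. 0 \<le> r" by (rule eventually_ge_at_top)
    then have "\<forall>\<^sub>F r in at_top. r * expectation (\<lambda>\<omega>. indicator {\<omega>\<in>space M. u * \<tau> (Z \<omega>) > r} \<omega> *
        \<phi> (?\<Theta> \<omega>)) = c * u * integral\<^sup>L \<sigma> \<phi>"
      by eventually_elim (simp add: True not_less[symmetric])
    then show ?thesis by (rule tendsto_eventually)
  next
    case False
    with u have u: "u > 0" by simp
    have "filterlim (\<lambda>r. r / u) at_top at_top" using u by real_asymp
    from filterlim_compose[OF lim1 this]
    have "((\<lambda>r. u * (r / u * expectation (\<lambda>\<omega>. indicator (?A (r / u)) \<omega> * \<phi> (?\<Theta> \<omega>)))) \<longlongrightarrow>
      u * (c * integral\<^sup>L \<sigma> \<phi>)) at_top"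
      by (rule tendsto_mult_left)
    moreover have "u * (r / u * e) = r * e" "?A (r / u) = {\<omega>\<in>space M. u * \<tau> (Z \<omega>) > r}"
      "u * (c * integral\<^sup>L \<sigma> \<phi>) = c * u * integral\<^sup>L \<sigma> \<phi>" for r e
      using u by (auto simp: pos_divide_less_eq mult.commute)
    ultimately show ?thesis by (simp only:)
  qed
qed

text \<open>In polar form \<open>f (Z \<omega>)\<close> is the radius times \<open>f\<close> at the
  angle. Where the latter is known up to \<delta>, the event \<open>f (Z \<omega>) > t\<close> lies
  between two purely radial events. Continuous tents localise that value, since weak convergence
  applies to continuous functions and not to indicators.\<close>

lemma (in prob_space) tendsto_tail_homogeneous:
  fixes Z :: "'a \<Rightarrow> 'b::{real_normed_vector, second_countable_topology}" and f :: "'b \<Rightarrow> real"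
  assumes RV: "RV1 M Z E (\<lambda>n. real n) c \<tau> \<sigma>"
    and \<tau>: "continuous_on UNIV \<tau>" "\<And>z. 0 \<le> \<tau> z"
    and f: "continuous_on UNIV f" "homogeneous1 f" "\<And>z. 0 \<le> f z" "\<And>z. f z \<le> C * \<tau> z"
  shows "((\<lambda>t. t * prob {\<omega>\<in>space M. f (Z \<omega>) > t}) \<longlongrightarrow> c * integral\<^sup>L \<sigma> f) at_top"
proof -
  have [measurable]: "Z \<in> borel_measurable M" "\<tau> \<in> borel_measurable borel" "f \<in> borel_measurable borel"
    using RV \<tau> f by (auto simp: RV1_def intro: borel_measurable_continuous_onI)
  interpret S: prob_space \<sigma> using RV by (simp add: RV1_def)
  have sets_\<sigma>[measurable_cong]: "sets \<sigma> = sets borel" and AE\<sigma>: "AE z in \<sigma>. \<tau> z = 1"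
    using RV by (auto simp: RV1_def)
  let ?\<Theta> = "\<lambda>\<omega>. Z \<omega> /\<^sub>R \<tau> (Z \<omega>)"
  have radial: "((\<lambda>r. r * prob {\<omega>\<in>space M. \<tau> (Z \<omega>) > r}) \<longlongrightarrow> c) at_top"
    using tendsto_angular_expectation[OF RV \<tau>(1), of "\<lambda>_. 1" 1] by (simp add: S.prob_space)
  \<comment> \<open>As a limit of nonnegative quantities; the sign is used to scale integral
    inequalities by \<open>c\<close> and to divide by \<open>2 * c + 1\<close>.\<close>
  have "c \<ge> 0"
    by (rule tendsto_lowerbound[OF radial]) (auto intro: eventually_mono[OF eventually_ge_at_top[of 0]])
  have f_bound: "AE z in \<sigma>. f z \<le> C" using AE\<sigma>
  proof eventually_elim
    case (elim z)
    then show ?case using f(4)[of z] by simp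
  qed
  have int_f: "integrable \<sigma> f"
    by (rule S.integrable_const_bound[of _ C]) (use f_bound f(3) in auto)
  \<comment> \<open>Where \<open>\<tau> (Z \<omega>) = 0\<close>, the bound by
    \<open>C * \<tau>\<close> forces \<open>f (Z \<omega>) = 0\<close>, so the identity holds
    everywhere. The angle is then the default value 0, and \<open>max 0 C\<close> still bounds
    \<open>f\<close> there.\<close>
  have polar: "f (Z \<omega>) = \<tau> (Z \<omega>) * f (?\<Theta> \<omega>)" "f (?\<Theta> \<omega>) \<le> max 0 C" for \<omega>
  proof -
    show "f (Z \<omega>) = \<tau> (Z \<omega>) * f (?\<Theta> \<omega>)"
    proof (cases "\<tau> (Z \<omega>) = 0")
      case True
      then show ?thesis using f(3,4)[of "Z \<omega>"] by simp
    qed (use f(2) \<tau>(2)[of "Z \<omega>"] in \<open>auto simp: homogeneous1_def\<close>)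
    have "f (?\<Theta> \<omega>) = f (Z \<omega>) / \<tau> (Z \<omega>)"
      using f(2) \<tau>(2)[of "Z \<omega>"] by (simp add: homogeneous1_def divide_inverse mult.commute)
    also have "\<dots> \<le> C * \<tau> (Z \<omega>) / \<tau> (Z \<omega>)"
      using f(4) \<tau>(2) by (rule divide_right_mono)
    also have "\<dots> \<le> max 0 C" by simp
    finally show "f (?\<Theta> \<omega>) \<le> max 0 C" .
  qed
  \<comment> \<open>The sandwich leaves an error of \<open>2 * c * \<delta>\<close>; the extra
    \<delta> gives strict inequalities that hold eventually.\<close>
  have bounds: "\<forall>\<^sub>F t in at_top. \<bar>t * prob {\<omega>\<in>space M. f (Z \<omega>) > t} - c * integral\<^sup>L \<sigma> f\<bar> < 2 * c * \<delta> + \<delta>"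
    if "\<delta> > 0" for \<delta>
  proof -
    \<comment> \<open>So many tents of spacing \<delta> cover all values that \<open>f\<close> takes
      at an angle.\<close>
    obtain m :: nat where "max 0 C / \<delta> < real m" using reals_Archimedean2 by blast
    then have m: "max 0 C \<le> real m * \<delta>" using \<open>\<delta> > 0\<close> by (simp add: field_simps)
    define \<phi> where "\<phi> k z = max 0 (1 - \<bar>f z / \<delta> - real k\<bar>)" for k z
    have \<phi>_cont: "continuous_on UNIV (\<phi> k)" for k
      unfolding \<phi>_def using \<open>\<delta> > 0\<close> by (intro continuous_intros f(1)) auto
    have \<phi>_nn: "0 \<le> \<phi> k z" "\<phi> k z \<le> 1" for k z by (auto simp: \<phi>_def)
    have \<phi>_bdd: "bounded (range (\<phi> k))" for k
      using \<phi>_nn by (intro boundedI[of _ 1]) auto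
    have [measurable]: "\<phi> k \<in> borel_measurable borel" for k
      by (rule borel_measurable_continuous_onI[OF \<phi>_cont])
    have \<phi>_int: "integrable \<sigma> (\<phi> k)" for k
      by (rule S.integrable_const_bound[of _ 1]) (use \<phi>_nn in auto)
    have \<phi>_sum: "(\<Sum>k\<le>m. \<phi> k z) = 1" if "f z \<le> max 0 C" for z
    proof -
      have "f z / \<delta> \<le> real m" using order_trans[OF that m] \<open>\<delta> > 0\<close> by (simp add: field_simps)
      then show ?thesis
        unfolding \<phi>_def using f(3)[of z] \<open>\<delta> > 0\<close> by (subst sum_tents) auto
    qed
    have \<phi>_supp: "(real k - 1) * \<delta> \<le> f z \<and> f z \<le> (real k + 1) * \<delta>" if "\<phi> k z \<noteq> 0" for k z
    proof -
      have "\<bar>f z / \<delta> - real k\<bar> < 1" using that by (auto simp: \<phi>_def max_def split: if_splits)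
      then have "real k - 1 \<le> f z / \<delta>" "f z / \<delta> \<le> real k + 1" by linarith+
      then show ?thesis using \<open>\<delta> > 0\<close> by (simp add: field_simps)
    qed
    define J where "J u k t = expectation (\<lambda>\<omega>. indicator {\<omega>\<in>space M. u * \<tau> (Z \<omega>) > t} \<omega> * \<phi> k (?\<Theta> \<omega>))"
      for u k and t :: real
    have J_lim: "((\<lambda>t. \<Sum>k\<le>m. t * J (u k) k t) \<longlongrightarrow> (\<Sum>k\<le>m. c * u k * integral\<^sup>L \<sigma> (\<phi> k))) at_top"
      if "\<And>k. 0 \<le> u k" for u :: "nat \<Rightarrow> real"
      unfolding J_def using that
      by (intro tendsto_sum tendsto_angular_expectation[OF RV \<tau>(1) \<phi>_cont \<phi>_bdd])
    have J_sum: "(\<Sum>k\<le>m. t * J (u k) k t) = t * expectation (\<lambda>\<omega>. \<Sum>k\<le>m.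
        indicator {\<omega>\<in>space M. u k * \<tau> (Z \<omega>) > t} \<omega> * \<phi> k (?\<Theta> \<omega>))" for u t
      unfolding J_def sum_distrib_left[symmetric]
      by (subst Bochner_Integration.integral_sum)
        (auto intro!: integrable_const_bound[of _ 1] simp: indicator_def \<phi>_nn)
    have integrable_J: "integrable M (\<lambda>\<omega>. \<Sum>k\<le>m. indicator {\<omega>\<in>space M. u k * \<tau> (Z \<omega>) > t} \<omega> * \<phi> k (?\<Theta> \<omega>))"
      for u and t :: real
    proof (rule Bochner_Integration.integrable_sum)
      show "integrable M (\<lambda>\<omega>. indicator {\<omega>\<in>space M. u k * \<tau> (Z \<omega>) > t} \<omega> * \<phi> k (?\<Theta> \<omega>))" for k
        by (intro integrable_const_bound[of _ 1]) (auto simp: indicator_def \<phi>_nn)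
    qed
    have prob_eq: "prob {\<omega>\<in>space M. f (Z \<omega>) > t} = expectation (indicator {\<omega>\<in>space M. f (Z \<omega>) > t})"
      for t by simp
    have [simp]: "integrable M (indicat_real {\<omega>\<in>space M. f (Z \<omega>) > t})" for t
      by (intro integrable_real_indicator) (auto simp: emeasure_eq_measure)
    \<comment> \<open>These are the ends of the range of \<open>f\<close> on the support of the
      \<open>k\<close>-th tent. The lower end is cut off at 0, since it would be negative for
      \<open>k = 0\<close> and the radial limit requires nonnegative factors.\<close>
    define u v :: "nat \<Rightarrow> real" where "u k = (real k + 1) * \<delta>" and "v k = max 0 (real k - 1) * \<delta>" for k
    have uv: "0 \<le> u k" "0 \<le> v k" for k using \<open>\<delta> > 0\<close> by (auto simp: u_def v_def)
    \<comment> \<open>The indicator of \<open>f (Z \<omega>) > t\<close> is split by the partition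
      of unity, and each summand is compared with the radial event of its tent.\<close>
    have up: "t * prob {\<omega>\<in>space M. f (Z \<omega>) > t} \<le> (\<Sum>k\<le>m. t * J (u k) k t)" if "t > 0" for t
      unfolding J_sum prob_eq
    proof (intro mult_left_mono integral_mono integrable_J)
      fix \<omega> assume "\<omega> \<in> space M"
      have "indicator {\<omega>\<in>space M. f (Z \<omega>) > t} \<omega> * \<phi> k (?\<Theta> \<omega>)
          \<le> indicator {\<omega>\<in>space M. u k * \<tau> (Z \<omega>) > t} \<omega> * \<phi> k (?\<Theta> \<omega>)" for k
      proof (cases "\<phi> k (?\<Theta> \<omega>) = 0")
        case False
        from \<phi>_supp[OF this] have "f (Z \<omega>) \<le> u k * \<tau> (Z \<omega>)"
          unfolding polar u_def using \<tau>(2) by (simp add: mult_left_mono mult.commute)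
        then show ?thesis using \<phi>_nn by (auto simp: indicator_def)
      qed simp
      then have "(\<Sum>k\<le>m. indicator {\<omega>\<in>space M. f (Z \<omega>) > t} \<omega> * \<phi> k (?\<Theta> \<omega>))
          \<le> (\<Sum>k\<le>m. indicator {\<omega>\<in>space M. u k * \<tau> (Z \<omega>) > t} \<omega> * \<phi> k (?\<Theta> \<omega>))"
        by (rule sum_mono)
      then show "indicator {\<omega>\<in>space M. f (Z \<omega>) > t} \<omega>
          \<le> (\<Sum>k\<le>m. indicator {\<omega>\<in>space M. u k * \<tau> (Z \<omega>) > t} \<omega> * \<phi> k (?\<Theta> \<omega>))"
        by (simp only: sum_distrib_left[symmetric] \<phi>_sum[OF polar(2)] mult_1_right)
    qed (use \<open>t > 0\<close> in auto)
    have lo: "(\<Sum>k\<le>m. t * J (v k) k t) \<le> t * prob {\<omega>\<in>space M. f (Z \<omega>) > t}" if "t > 0" for t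
      unfolding J_sum prob_eq
    proof (intro mult_left_mono integral_mono integrable_J)
      fix \<omega> assume "\<omega> \<in> space M"
      have "indicator {\<omega>\<in>space M. v k * \<tau> (Z \<omega>) > t} \<omega> * \<phi> k (?\<Theta> \<omega>)
          \<le> indicator {\<omega>\<in>space M. f (Z \<omega>) > t} \<omega> * \<phi> k (?\<Theta> \<omega>)" for k
      proof (cases "\<phi> k (?\<Theta> \<omega>) = 0")
        case False
        from \<phi>_supp[OF this] f(3)[of "?\<Theta> \<omega>"] \<open>\<delta> > 0\<close> have "v k \<le> f (?\<Theta> \<omega>)"
          by (auto simp: v_def max_def)
        from mult_left_mono[OF this \<tau>(2)[of "Z \<omega>"]] have "v k * \<tau> (Z \<omega>) \<le> f (Z \<omega>)"
          unfolding polar by (simp add: mult.commute)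
        then show ?thesis using \<phi>_nn by (auto simp: indicator_def)
      qed simp
      then have "(\<Sum>k\<le>m. indicator {\<omega>\<in>space M. v k * \<tau> (Z \<omega>) > t} \<omega> * \<phi> k (?\<Theta> \<omega>))
         \<le> (\<Sum>k\<le>m. indicator {\<omega>\<in>space M. f (Z \<omega>) > t} \<omega> * \<phi> k (?\<Theta> \<omega>))"
        by (rule sum_mono)
      then show "(\<Sum>k\<le>m. indicator {\<omega>\<in>space M. v k * \<tau> (Z \<omega>) > t} \<omega> * \<phi> k (?\<Theta> \<omega>))
         \<le> indicator {\<omega>\<in>space M. f (Z \<omega>) > t} \<omega>"
        by (simp only: sum_distrib_left[symmetric] \<phi>_sum[OF polar(2)] mult_1_right)
    qed (use \<open>t > 0\<close> in auto)
    have int_sum: "(\<Sum>k\<le>m. w k * integral\<^sup>L \<sigma> (\<phi> k)) = (\<integral>z. (\<Sum>k\<le>m. w k * \<phi> k z) \<partial>\<sigma>)"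
      "integrable \<sigma> (\<lambda>z. \<Sum>k\<le>m. w k * \<phi> k z)" for w :: "nat \<Rightarrow> real"
      using \<phi>_int by (auto simp: Bochner_Integration.integral_sum)
    \<comment> \<open>Expanding \<open>f z + e\<close> along the partition of unity reduces the
      comparison of integrals to one tent at a time, with \<open>e\<close> equal to
      \<open>2 * \<delta>\<close> or \<open>- 2 * \<delta>\<close>, the width of the support of a
      tent.\<close>
    have f\<phi>: "AE z in \<sigma>. (\<Sum>k\<le>m. (f z + e) * \<phi> k z) = f z + e" for e
      using f_bound by eventually_elim (auto simp: sum_distrib_left[symmetric] \<phi>_sum)
    have "(\<integral>z. (\<Sum>k\<le>m. u k * \<phi> k z) \<partial>\<sigma>) \<le> (\<integral>z. f z + 2 * \<delta> \<partial>\<sigma>)"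
    proof (rule integral_mono_AE)
      show "AE z in \<sigma>. (\<Sum>k\<le>m. u k * \<phi> k z) \<le> f z + 2 * \<delta>"
        using f\<phi>[of "2 * \<delta>"]
      proof eventually_elim
        case (elim z)
        have "u k * \<phi> k z \<le> (f z + 2 * \<delta>) * \<phi> k z" for k
        proof (cases "\<phi> k z = 0")
          case False
          from \<phi>_supp[OF this] have "u k \<le> f z + 2 * \<delta>" by (simp add: u_def algebra_simps)
          then show ?thesis using \<phi>_nn[of k z] by (intro mult_right_mono) auto
        qed simp
        then show ?case by (metis (no_types, lifting) elim sum_mono)
      qed
    qed (use int_f int_sum in auto)
    then have u_int: "(\<Sum>k\<le>m. c * u k * integral\<^sup>L \<sigma> (\<phi> k)) \<le> c * (integral\<^sup>L \<sigma> f + 2 * \<delta>)"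
      using \<open>c \<ge> 0\<close> int_f
      by (simp add: mult.assoc sum_distrib_left[symmetric] int_sum mult_left_mono S.prob_space)
    have "(\<integral>z. f z + - 2 * \<delta> \<partial>\<sigma>) \<le> (\<integral>z. (\<Sum>k\<le>m. v k * \<phi> k z) \<partial>\<sigma>)"
    proof (rule integral_mono_AE)
      show "AE z in \<sigma>. f z + - 2 * \<delta> \<le> (\<Sum>k\<le>m. v k * \<phi> k z)"
        using f\<phi>[of "- 2 * \<delta>"]
      proof eventually_elim
        case (elim z)
        have "(f z + - 2 * \<delta>) * \<phi> k z \<le> v k * \<phi> k z" for k
        proof (cases "\<phi> k z = 0")
          case False
          have "(real k - 1) * \<delta> \<le> v k" using \<open>\<delta> > 0\<close> by (auto simp: v_def)
          with \<phi>_supp[OF False] have "f z + - 2 * \<delta> \<le> v k" by (simp add: algebra_simps)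
          then show ?thesis using \<phi>_nn[of k z] by (intro mult_right_mono) auto
        qed simp
        then show ?case by (metis (no_types, lifting) elim sum_mono)
      qed
    qed (use int_f int_sum in auto)
    then have v_int: "c * (integral\<^sup>L \<sigma> f - 2 * \<delta>) \<le> (\<Sum>k\<le>m. c * v k * integral\<^sup>L \<sigma> (\<phi> k))"
      using \<open>c \<ge> 0\<close> int_f
      by (simp add: mult.assoc sum_distrib_left[symmetric] int_sum mult_left_mono S.prob_space)
    have "c * (integral\<^sup>L \<sigma> f - 2 * \<delta>) - \<delta> < (\<Sum>k\<le>m. c * v k * integral\<^sup>L \<sigma> (\<phi> k))"
      using v_int \<open>\<delta> > 0\<close> by linarith
    note ev_lo = order_tendstoD(1)[OF J_lim[OF uv(2)] this]
    have "(\<Sum>k\<le>m. c * u k * integral\<^sup>L \<sigma> (\<phi> k)) < c * (integral\<^sup>L \<sigma> f + 2 * \<delta>) + \<delta>"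
      using u_int \<open>\<delta> > 0\<close> by linarith
    note ev_up = order_tendstoD(2)[OF J_lim[OF uv(1)] this]
    show ?thesis using ev_lo ev_up eventually_gt_at_top[of 0]
    proof eventually_elim
      case (elim t)
      with up[of t] lo[of t] show ?case by (simp add: abs_less_iff algebra_simps)
    qed
  qed
  show ?thesis
  proof (rule tendstoI)
    fix e :: real assume "e > 0"
    \<comment> \<open>Chosen so that the total error \<open>2 * c * \<delta> + \<delta>\<close> is
      exactly \<open>e\<close>.\<close>
    define \<delta> where "\<delta> = e / (2 * c + 1)"
    have "\<delta> > 0" using \<open>e > 0\<close> \<open>c \<ge> 0\<close> by (simp add: \<delta>_def)
    have "(2 * c + 1) * \<delta> = e" unfolding \<delta>_def using \<open>c \<ge> 0\<close> by simp
    then have "2 * c * \<delta> + \<delta> = e" by (simp add: distrib_right)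
    with bounds[OF \<open>\<delta> > 0\<close>]
    show "\<forall>\<^sub>F t in at_top. dist (t * prob {\<omega>\<in>space M. f (Z \<omega>) > t}) (c * integral\<^sup>L \<sigma> f) < e"
      by (simp add: dist_real_def)
  qed
qed

section \<open>Quantiles, precision and calibration\<close>

lemma (in prob_space) quantile_eq:
  assumes [measurable]: "W \<in> borel_measurable M"
  shows "quantile M W q = Inf {x. \<P>(\<omega> in M. W \<omega> > x) \<le> 1 - q}"
proof -
  have "cdf (distr M borel W) x = 1 - \<P>(\<omega> in M. W \<omega> > x)" for x
  proof -
    have "cdf (distr M borel W) x = \<P>(\<omega> in M. \<not> W \<omega> > x)"
      by (auto simp: cdf_def measure_distr not_less intro!: arg_cong[where f=prob])
    then show ?thesis by (simp add: prob_neg)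
  qed
  then show ?thesis by (simp add: quantile_def le_diff_eq add.commute)
qed

text \<open>At the test points \<open>(\<beta> - \<epsilon>) / (1 - q)\<close> and
  \<open>(\<beta> + \<epsilon>) / (1 - q)\<close> the tail is eventually above and below
  \<open>1 - q\<close>, respectively. As the tail is antimonotone, the quantile lies between
  them.\<close>

lemma (in prob_space) tendsto_quantile:
  assumes [measurable]: "W \<in> borel_measurable M"
    and lim: "((\<lambda>t. t * \<P>(\<omega> in M. W \<omega> > t)) \<longlongrightarrow> \<beta>) at_top" and "\<beta> > 0"
  shows "((\<lambda>q. (1 - q) * quantile M W q) \<longlongrightarrow> \<beta>) (at_left 1)"
proof -
  let ?G = "\<lambda>t. \<P>(\<omega> in M. W \<omega> > t)"
  have key: "\<forall>\<^sub>F q in at_left 1. \<beta> - \<epsilon> \<le> (1 - q) * quantile M W q \<and> (1 - q) * quantile M W q \<le> \<beta> + \<epsilon>"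
    if \<epsilon>: "0 < \<epsilon>" "\<epsilon> < \<beta>" for \<epsilon>
  proof -
    have "filterlim (\<lambda>q. (\<beta> - \<epsilon>) / (1 - q)) at_top (at_left 1)"
      "filterlim (\<lambda>q. (\<beta> + \<epsilon>) / (1 - q)) at_top (at_left 1)"
      using \<epsilon> by real_asymp+
    from this[THEN filterlim_compose[OF lim]]
    have ev: "\<forall>\<^sub>F q in at_left 1. \<beta> - \<epsilon> < (\<beta> - \<epsilon>) / (1 - q) * ?G ((\<beta> - \<epsilon>) / (1 - q))"
      "\<forall>\<^sub>F q in at_left 1. (\<beta> + \<epsilon>) / (1 - q) * ?G ((\<beta> + \<epsilon>) / (1 - q)) < \<beta> + \<epsilon>"
      using \<epsilon>(1) by (auto intro: order_tendstoD)
    have "\<forall>\<^sub>F q in at_left 1. q < (1::real)" by (simp add: eventually_at_filter)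
    with ev show ?thesis
    proof eventually_elim
      case (elim q)
      let ?S = "{x. ?G x \<le> 1 - q}"
      let ?y = "(\<beta> - \<epsilon>) / (1 - q)" and ?x = "(\<beta> + \<epsilon>) / (1 - q)"
      \<comment> \<open>Translates the limit statements at the test points into comparisons of the
        tail with \<open>1 - q\<close>.\<close>
      have scale: "a < a / e * g \<longleftrightarrow> e < g" "a / e * g < a \<longleftrightarrow> g < e" if "a > 0" "e > 0" for a e g :: real
        using that by (simp_all add: field_simps)
      have "1 - q < ?G ?y" using elim \<epsilon> by (subst (asm) scale(1)) auto
      then have lower: "?y \<le> x" if "x \<in> ?S" for x
        using that antimonoD[OF tail_prob_antimono[of W], of x ?y] by force
      have "?G ?x < 1 - q" using elim \<epsilon> by (subst (asm) scale(2)) auto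
      then have mem: "?x \<in> ?S" by simp
      have "?y \<le> Inf ?S" using mem lower by (intro cInf_greatest) auto
      moreover have "Inf ?S \<le> ?x" using mem lower by (intro cInf_lower bdd_belowI)
      ultimately show ?case using elim by (simp add: quantile_eq field_simps)
    qed
  qed
  show ?thesis
  proof (rule tendstoI)
    fix e :: real assume "e > 0"
    \<comment> \<open>The bound by \<open>\<beta> / 2\<close> keeps the lower test point positive,
      so that it tends to infinity as \<open>q\<close> tends to 1.\<close>
    with \<open>\<beta> > 0\<close> have "0 < min (e / 2) (\<beta> / 2)" "min (e / 2) (\<beta> / 2) < \<beta>" by auto
    from key[OF this] show "\<forall>\<^sub>F q in at_left 1. dist ((1 - q) * quantile M W q) \<beta> < e"
    proof eventually_elim
      case (elim q)
      have "min (e / 2) (\<beta> / 2) < e" using \<open>e > 0\<close> by auto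
      with elim show ?case by (auto simp: dist_real_def abs_less_iff)
    qed
  qed
qed

text \<open>Equal tail constants make both quantiles asymptotic to \<open>\<beta> / (1 - q)\<close>.
  The joint exceedance is therefore asymptotically that of
  \<open>min (Y \<omega>) (W \<omega>)\<close> over a common threshold, and dividing by the tail of
  \<open>W\<close> gives the limit.\<close>

lemma (in prob_space) tendsto_precision:
  assumes [measurable]: "Y \<in> borel_measurable M" "W \<in> borel_measurable M"
    and Y: "((\<lambda>t. t * \<P>(\<omega> in M. Y \<omega> > t)) \<longlongrightarrow> \<beta>) at_top"
    and W: "((\<lambda>t. t * \<P>(\<omega> in M. W \<omega> > t)) \<longlongrightarrow> \<beta>) at_top"
    and YW: "((\<lambda>t. t * \<P>(\<omega> in M. min (Y \<omega>) (W \<omega>) > t)) \<longlongrightarrow> \<kappa>) at_top"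
    and "\<beta> > 0"
  shows "(precision M Y W \<longlongrightarrow> \<kappa> / \<beta>) (at_left 1)"
proof -
  let ?u = "quantile M Y" and ?v = "quantile M W"
  have q1: "\<forall>\<^sub>F q in at_left 1. q < (1::real)" by (simp add: eventually_at_filter)
  \<comment> \<open>Any threshold asymptotic to \<open>\<beta> / (1 - q)\<close> will do; this is
    applied to the quantile of \<open>W\<close> and to the maximum and minimum of both
    quantiles.\<close>
  have tail: "((\<lambda>q. \<P>(\<omega> in M. V \<omega> > s q) / (1 - q)) \<longlongrightarrow> l / \<beta>) (at_left 1)"
    if V: "((\<lambda>t. t * \<P>(\<omega> in M. V \<omega> > t)) \<longlongrightarrow> l) at_top"
      and s: "((\<lambda>q. (1 - q) * s q) \<longlongrightarrow> \<beta>) (at_left 1)" for V l and s :: "real \<Rightarrow> real"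
  proof -
    have "filterlim (\<lambda>q::real. 1 / (1 - q)) at_top (at_left 1)" by real_asymp
    from filterlim_tendsto_pos_mult_at_top[OF s \<open>\<beta> > 0\<close> this]
    have top: "filterlim s at_top (at_left 1)"
      by (rule filterlim_mono_eventually[OF _ order.refl order.refl])
         (use q1 in eventually_elim, simp)
    have "((\<lambda>q. (s q * \<P>(\<omega> in M. V \<omega> > s q)) / ((1 - q) * s q)) \<longlongrightarrow> l / \<beta>) (at_left 1)"
      using \<open>\<beta> > 0\<close> by (intro tendsto_divide filterlim_compose[OF V top] s) auto
    moreover have "\<forall>\<^sub>F q in at_left 1. s q > 0"
      using top by (simp add: filterlim_at_top_dense)
    ultimately show ?thesis
      by (rule Lim_transform_eventually[OF _ eventually_mono]) simp
  qed
  have u: "((\<lambda>q. (1 - q) * ?u q) \<longlongrightarrow> \<beta>) (at_left 1)" and v: "((\<lambda>q. (1 - q) * ?v q) \<longlongrightarrow> \<beta>) (at_left 1)"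
    using Y W \<open>\<beta> > 0\<close> by (auto intro!: tendsto_quantile)
  have "((\<lambda>q. max ((1 - q) * ?u q) ((1 - q) * ?v q)) \<longlongrightarrow> max \<beta> \<beta>) (at_left 1)"
    by (intro tendsto_max u v)
  then have mx: "((\<lambda>q. (1 - q) * max (?u q) (?v q)) \<longlongrightarrow> \<beta>) (at_left 1)"
    unfolding max.idem
    by (rule Lim_transform_eventually) (use q1 in eventually_elim, simp add: max_mult_distrib_left)
  have "((\<lambda>q. min ((1 - q) * ?u q) ((1 - q) * ?v q)) \<longlongrightarrow> min \<beta> \<beta>) (at_left 1)"
    by (intro tendsto_min u v)
  then have mn: "((\<lambda>q. (1 - q) * min (?u q) (?v q)) \<longlongrightarrow> \<beta>) (at_left 1)"
    unfolding min.idem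
    by (rule Lim_transform_eventually) (use q1 in eventually_elim, simp add: min_mult_distrib_left)
  \<comment> \<open>Exceeding the larger quantile by both variables implies the joint event, which
    in turn implies exceeding the smaller one by both.\<close>
  have joint: "((\<lambda>q. \<P>(\<omega> in M. Y \<omega> > ?u q \<and> W \<omega> > ?v q) / (1 - q)) \<longlongrightarrow> \<kappa> / \<beta>) (at_left 1)"
  proof (rule tendsto_sandwich[OF _ _ tail[OF YW mx] tail[OF YW mn]])
    show "\<forall>\<^sub>F q in at_left 1. \<P>(\<omega> in M. min (Y \<omega>) (W \<omega>) > max (?u q) (?v q)) / (1 - q)
        \<le> \<P>(\<omega> in M. Y \<omega> > ?u q \<and> W \<omega> > ?v q) / (1 - q)"
      using q1 by eventually_elim (auto intro!: divide_right_mono finite_measure_mono)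
    show "\<forall>\<^sub>F q in at_left 1. \<P>(\<omega> in M. Y \<omega> > ?u q \<and> W \<omega> > ?v q) / (1 - q)
        \<le> \<P>(\<omega> in M. min (Y \<omega>) (W \<omega>) > min (?u q) (?v q)) / (1 - q)"
      using q1 by eventually_elim (auto intro!: divide_right_mono finite_measure_mono)
  qed
  have "((\<lambda>q. (\<P>(\<omega> in M. Y \<omega> > ?u q \<and> W \<omega> > ?v q) / (1 - q)) /
      (\<P>(\<omega> in M. W \<omega> > ?v q) / (1 - q))) \<longlongrightarrow> (\<kappa> / \<beta>) / (\<beta> / \<beta>)) (at_left 1)"
    using \<open>\<beta> > 0\<close> by (intro tendsto_divide joint tail[OF W v]) auto
  then have "((\<lambda>q. (\<P>(\<omega> in M. Y \<omega> > ?u q \<and> W \<omega> > ?v q) / (1 - q)) /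
      (\<P>(\<omega> in M. W \<omega> > ?v q) / (1 - q))) \<longlongrightarrow> \<kappa> / \<beta>) (at_left 1)"
    using \<open>\<beta> > 0\<close> by simp
  then show ?thesis
    by (rule Lim_transform_eventually)
      (use q1 in eventually_elim, simp add: precision_def cond_prob_def)
qed

text \<open>Multiplying both tails by \<open>t\<close> turns asymptotic equivalence into equality of
  the limits; for the converse, \<open>\<beta> > 0\<close> lets the quotient of the limits be
  taken.\<close>

lemma (in prob_space) asymptotically_calibrated_iff:
  assumes Y: "((\<lambda>t. t * \<P>(\<omega> in M. Y \<omega> > t)) \<longlongrightarrow> \<beta>) at_top"
    and W: "((\<lambda>t. t * \<P>(\<omega> in M. W \<omega> > t)) \<longlongrightarrow> \<gamma>) at_top"
    and "\<beta> > 0"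
  shows "asymptotically_calibrated M Y W \<longleftrightarrow> \<gamma> = \<beta>"
proof
  assume "asymptotically_calibrated M Y W"
  then have "(\<lambda>t. t * \<P>(\<omega> in M. W \<omega> > t)) \<sim>[at_top] (\<lambda>t. t * \<P>(\<omega> in M. Y \<omega> > t))"
    unfolding asymptotically_calibrated_def by (intro asymp_equiv_mult asymp_equiv_refl)
  from tendsto_asymp_equiv_cong[OF this, of \<beta>] Y
  have "((\<lambda>t. t * \<P>(\<omega> in M. W \<omega> > t)) \<longlongrightarrow> \<beta>) at_top" by simp
  with W show "\<gamma> = \<beta>" using tendsto_unique trivial_limit_at_top_linorder by blast
next
  assume "\<gamma> = \<beta>"
  have "((\<lambda>t. (t * \<P>(\<omega> in M. W \<omega> > t)) / (t * \<P>(\<omega> in M. Y \<omega> > t))) \<longlongrightarrow> \<gamma> / \<beta>) at_top"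
    using \<open>\<beta> > 0\<close> by (intro tendsto_divide W Y) auto
  then have "((\<lambda>t. \<P>(\<omega> in M. W \<omega> > t) / \<P>(\<omega> in M. Y \<omega> > t)) \<longlongrightarrow> 1) at_top"
    using \<open>\<gamma> = \<beta>\<close> \<open>\<beta> > 0\<close>
    by (auto elim!: Lim_transform_eventually intro: eventually_mono[OF eventually_gt_at_top[of 0]])
  then show "asymptotically_calibrated M Y W"
    unfolding asymptotically_calibrated_def by (rule asymp_equivI')
qed

section \<open>Arbitrary norms and homogeneous functions on Euclidean space\<close>

text \<open>From \<open>0 = N (x - x) \<le> N x + N (- x) = 2 * N x\<close>.\<close>

lemma is_norm_nonneg:
  assumes "is_norm N"
  shows "0 \<le> N x"
proof -
  have "N (x + - 1 *\<^sub>R x) \<le> N x + N (- 1 *\<^sub>R x)" "N (- 1 *\<^sub>R x) = \<bar>- 1\<bar> * N x" "N (x + - 1 *\<^sub>R x) = 0"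
    using assms unfolding is_norm_def by (blast, blast, simp)
  then show ?thesis by simp
qed

text \<open>Expansion in the standard basis bounds \<open>N\<close> by a multiple \<open>K\<close>
  of the Euclidean norm; by the reverse triangle inequality \<open>N\<close> is then Lipschitz with
  constant \<open>K\<close>.\<close>

lemma is_norm_continuous_on:
  fixes N :: "'a::euclidean_space \<Rightarrow> real"
  assumes "is_norm N"
  shows "continuous_on S N"
proof -
  have tri: "N (x + y) \<le> N x + N y" and scale: "N (s *\<^sub>R x) = \<bar>s\<bar> * N x" and zero: "N 0 = 0" for x y s
    using assms by (auto simp: is_norm_def)
  define K where "K = (\<Sum>e\<in>Basis. N e)"
  have bound: "N x \<le> K * norm x" for x
  proof -
    have sums: "N (\<Sum>e\<in>A. g e) \<le> (\<Sum>e\<in>A. N (g e))" if "finite A" for A and g :: "'a \<Rightarrow> 'a"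
      using that by induction (auto simp: zero intro: order_trans[OF tri])
    have "N x = N (\<Sum>e\<in>Basis. (x \<bullet> e) *\<^sub>R e)" by (simp add: euclidean_representation)
    also have "\<dots> \<le> (\<Sum>e\<in>Basis. N ((x \<bullet> e) *\<^sub>R e))" by (rule sums) simp
    also have "\<dots> \<le> (\<Sum>e\<in>Basis. N e * norm x)"
      by (intro sum_mono)
        (simp add: scale mult.commute mult_left_mono Basis_le_norm is_norm_nonneg[OF assms])
    finally show ?thesis by (simp add: K_def sum_distrib_right)
  qed
  have "dist (N x) (N y) \<le> K * dist x y" for x y
    using tri[of y "x - y"] tri[of x "y - x"] bound[of "x - y"] bound[of "y - x"]
    by (simp add: dist_real_def dist_norm norm_minus_commute abs_le_iff)
  moreover have "K \<ge> 0" by (simp add: K_def sum_nonneg is_norm_nonneg[OF assms])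
  ultimately have "K-lipschitz_on S N" by (intro lipschitz_onI) auto
  then show ?thesis by (rule lipschitz_on_continuous_on)
qed

text \<open>The quotient \<open>g x / N x\<close> is continuous on the compact Euclidean unit
  sphere, hence bounded there, and homogeneity carries the bound to all \<open>x\<close>. This
  supplies the domination by the modulus that the tail limit requires.\<close>

lemma homogeneous1_le_norm:
  fixes N :: "'a::euclidean_space \<Rightarrow> real"
  assumes N: "is_norm N" and g: "continuous_on UNIV g" "homogeneous1 g"
  obtains C where "0 \<le> C" "\<And>x. g x \<le> C * N x"
proof -
  have "continuous_on (sphere 0 1) (\<lambda>x. g x / N x)"
    using N by (intro continuous_intros is_norm_continuous_on continuous_on_subset[OF g(1)])
      (auto simp: is_norm_def)
  then have "compact ((\<lambda>x. g x / N x) ` sphere 0 1)" by (intro compact_continuous_image) auto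
  then obtain C where C: "\<And>x. norm x = 1 \<Longrightarrow> g x / N x \<le> C"
    using compact_imp_bounded[THEN bounded_imp_bdd_above] by (fastforce simp: bdd_above_def)
  have "g x \<le> max 0 C * N x" for x
  proof (cases "x = 0")
    case True
    then show ?thesis using g(2) N unfolding homogeneous1_def is_norm_def
      by (metis abs_0 mult_zero_left mult_zero_right order_refl scaleR_zero_left)
  next
    case False
    define y where "y = x /\<^sub>R norm x"
    have y: "norm y = 1" "x = norm x *\<^sub>R y" using False by (auto simp: y_def)
    have "N y > 0" using is_norm_nonneg[OF N, of y] N y(1) by (auto simp: is_norm_def less_le)
    then have "g y \<le> max 0 C * N y" using C[OF y(1)] by (auto simp: divide_simps max_def mult.commute)
         (smt (verit) mult_nonneg_nonneg mult_nonpos_nonneg)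
    then have "norm x * g y \<le> norm x * (max 0 C * N y)" by (rule mult_left_mono) simp
    moreover have "g x = norm x * g y" using g(2) y(2) unfolding homogeneous1_def by (metis norm_ge_zero)
    moreover have "N x = norm x * N y" using N y(2) unfolding is_norm_def by (metis abs_norm_cancel)
    ultimately show ?thesis by (simp add: ac_simps)
  qed
  then show thesis by (intro that[of "max 0 C"]) auto
qed

section \<open>Discrete angular measures, interpolation along rays and the modulus\<close>

text \<open>Homogeneity cancels the weight \<open>\<tau> (c i)\<close> against the normalisation of
  the atom. Atoms of weight zero have \<open>c i = 0\<close>, where \<open>f\<close> vanishes as
  well.\<close>

lemma integral_discrete_angular_measure:
  fixes f :: "'a::real_normed_vector \<Rightarrow> real"
  assumes f: "f \<in> borel_measurable borel" "homogeneous1 f"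
    and \<tau>: "\<And>i. i \<in> {1..p} \<Longrightarrow> 0 \<le> \<tau> (c i)" "\<And>i. i \<in> {1..p} \<Longrightarrow> \<tau> (c i) = 0 \<Longrightarrow> c i = 0"
    and pos: "0 < (\<Sum>i=1..p. \<tau> (c i))"
  shows "(\<Sum>i=1..p. \<tau> (c i)) * integral\<^sup>L (discrete_angular_measure \<tau> p c) f = (\<Sum>i=1..p. f (c i))"
proof -
  let ?c = "\<Sum>i=1..p. \<tau> (c i)"
  have "f 0 = 0" using f(2) unfolding homogeneous1_def by (metis mult_zero_left order_refl scaleR_zero_left)
  have "integral\<^sup>L (discrete_angular_measure \<tau> p c) f = (\<Sum>i=1..p. \<tau> (c i) / ?c * f (c i /\<^sub>R \<tau> (c i)))"
    unfolding discrete_angular_measure_def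
  proof (subst integral_distr)
    show "integral\<^sup>L (point_measure {1..p} (\<lambda>i. ennreal (\<tau> (c i) / ?c))) (\<lambda>i. f (c i /\<^sub>R \<tau> (c i)))
        = (\<Sum>i=1..p. \<tau> (c i) / ?c * f (c i /\<^sub>R \<tau> (c i)))"
      using \<tau>(1) pos by (subst lebesgue_integral_point_measure_finite) auto
  qed (use f(1) in auto)
  also have "?c * \<dots> = (\<Sum>i=1..p. \<tau> (c i) * f (c i /\<^sub>R \<tau> (c i)))"
    using pos by (simp add: sum_distrib_left)
  also have "\<dots> = (\<Sum>i=1..p. f (c i))"
  proof (rule sum.cong)
    fix i assume i: "i \<in> {1..p}"
    show "\<tau> (c i) * f (c i /\<^sub>R \<tau> (c i)) = f (c i)"
    proof (cases "\<tau> (c i) = 0")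
      case True
      with \<tau>(2)[OF i] \<open>f 0 = 0\<close> show ?thesis by simp
    next
      case False
      with \<tau>(1)[OF i] f(2) show ?thesis by (simp add: homogeneous1_def)
    qed
  qed simp
  finally show ?thesis .
qed

text \<open>Finitely many distinct directions can be separated by cones, so a sum of homogeneous
  bumps, one per direction, takes independent values on the rays.\<close>

lemma exists_homogeneous1_interpolation:
  fixes N :: "'a::euclidean_space \<Rightarrow> real"
  assumes N: "is_norm N" and "finite I"
    and nz: "\<And>i. i \<in> I \<Longrightarrow> a i \<noteq> 0"
    and dist: "\<And>i j. i \<in> I \<Longrightarrow> j \<in> I \<Longrightarrow> i \<noteq> j \<Longrightarrow> a i /\<^sub>R N (a i) \<noteq> a j /\<^sub>R N (a j)"
    and y: "\<And>i. i \<in> I \<Longrightarrow> (0::real) \<le> y i"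
  obtains h where "continuous_on UNIV h" "\<And>x. 0 \<le> h x" "homogeneous1 h" "\<And>i. i \<in> I \<Longrightarrow> h (a i) = y i"
proof -
  have scale: "N (s *\<^sub>R x) = \<bar>s\<bar> * N x" and zero: "N x = 0 \<longleftrightarrow> x = 0" for x s
    using N by (auto simp: is_norm_def)
  note nn = is_norm_nonneg[OF N]
  have pos: "N (a i) > 0" if "i \<in> I" for i using nz[OF that] zero[of "a i"] nn[of "a i"] by simp
  define u where "u i = a i /\<^sub>R N (a i)" for i
  \<comment> \<open>A crude common bound for all reciprocal distances; the diagonal terms are
    \<open>1 / 0 = 0\<close>.\<close>
  define K where "K = (\<Sum>(i, j)\<in>I \<times> I. 1 / N (u i - u j))"
  have K: "1 \<le> K * N (u i - u j)" if "i \<in> I" "j \<in> I" "i \<noteq> j" for i j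
  proof -
    have "u i - u j \<noteq> 0" using dist[OF that] by (auto simp: u_def)
    then have "N (u i - u j) > 0" using zero[of "u i - u j"] nn[of "u i - u j"] by auto
    moreover have "1 / N (u i - u j) \<le> K"
      unfolding K_def using that \<open>finite I\<close> nn
        member_le_sum[of "(i, j)" "I \<times> I" "\<lambda>(i, j). 1 / N (u i - u j)"] by auto
    ultimately show ?thesis by (simp add: field_simps)
  qed
  \<comment> \<open>The \<open>i\<close>-th summand is supported in a cone around \<open>a i\<close> that contains no other \<open>a j\<close>.\<close>
  define h where "h x = (\<Sum>i\<in>I. y i / N (a i) * max 0 (N x - K * N (x - N x *\<^sub>R u i)))" for x
  show thesis
  proof
    have "continuous_on UNIV (\<lambda>x. N (x - N x *\<^sub>R u i))" for i
      by (rule continuous_on_compose2[OF is_norm_continuous_on[OF N, of UNIV]])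
        (intro continuous_intros is_norm_continuous_on[OF N], auto)
    then show "continuous_on UNIV h"
      unfolding h_def by (intro continuous_intros is_norm_continuous_on[OF N])
    show "0 \<le> h x" for x unfolding h_def using y pos by (intro sum_nonneg) (auto simp: less_imp_le)
    show "homogeneous1 h"
      unfolding homogeneous1_def
    proof clarify
      fix s x assume "0 \<le> (s::real)"
      have "N (s *\<^sub>R x - N (s *\<^sub>R x) *\<^sub>R u i) = s * N (x - N x *\<^sub>R u i)" for i
        using scale[of s "x - N x *\<^sub>R u i"] \<open>0 \<le> s\<close> by (simp add: scale scaleR_diff_right)
      then have "max 0 (N (s *\<^sub>R x) - K * N (s *\<^sub>R x - N (s *\<^sub>R x) *\<^sub>R u i))
          = s * max 0 (N x - K * N (x - N x *\<^sub>R u i))" for i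
        using \<open>0 \<le> s\<close> max_mult_distrib_left[of s 0 "N x - K * N (x - N x *\<^sub>R u i)"]
        by (simp add: scale algebra_simps)
      then show "h (s *\<^sub>R x) = s * h x" by (simp add: h_def sum_distrib_left mult.left_commute)
    qed
    fix j assume j: "j \<in> I"
    have "y i / N (a i) * max 0 (N (a j) - K * N (a j - N (a j) *\<^sub>R u i)) = (if i = j then y j else 0)"
      if i: "i \<in> I" for i
    proof -
      \<comment> \<open>At \<open>a j\<close> the \<open>i\<close>-th bump is the positive part of
        \<open>N (a j) * (1 - K * N (u j - u i))\<close>: it equals \<open>N (a j)\<close> for
        \<open>i = j\<close> and vanishes otherwise by the choice of \<open>K\<close>.\<close>
      have "a j = N (a j) *\<^sub>R u j" using pos[OF j] by (simp add: u_def)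
      then have "a j - N (a j) *\<^sub>R u i = N (a j) *\<^sub>R (u j - u i)"
        by (simp add: scaleR_diff_right)
      then have "N (a j - N (a j) *\<^sub>R u i) = N (a j) * N (u j - u i)"
        using pos[OF j] by (simp add: scale)
      then have "N (a j) - K * N (a j - N (a j) *\<^sub>R u i) = N (a j) * (1 - K * N (u j - u i))"
        by (simp add: algebra_simps)
      moreover have "N (a j) * (1 - K * N (u j - u i)) \<le> 0" if "i \<noteq> j"
        using K[OF j i] that pos[OF j] by (intro mult_nonneg_nonpos) auto
      moreover have "N (u j - u j) = 0" by (simp add: zero)
      ultimately show ?thesis using pos[OF j] by (auto simp: max_def)
    qed
    then show "h (a j) = y j" unfolding h_def using j \<open>finite I\<close> by simp
  qed
qed

text \<open>Because of the positive part the modulus is not itself a norm: its zero set is a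
  half-line, which meets the set of \<open>y \<ge> 0\<close> only in the origin.\<close>

lemma modulus_is_norm:
  fixes N :: "'a::euclidean_space \<Rightarrow> real"
  assumes "is_norm N"
  shows "continuous_on UNIV (modulus N)" "0 \<le> modulus N z"
    and "modulus N z = 0 \<longleftrightarrow> fst z \<le> 0 \<and> snd z = 0"
proof -
  have "continuous_on UNIV (\<lambda>z :: real \<times> 'a. N (snd z))"
    by (rule continuous_on_compose2[OF is_norm_continuous_on[OF assms, of UNIV]])
      (auto intro: continuous_intros)
  then show "continuous_on UNIV (modulus N)"
    unfolding modulus_def by (intro continuous_intros)
  have "0 \<le> N (snd z)" "N (snd z) = 0 \<longleftrightarrow> snd z = 0"
    using assms is_norm_nonneg[OF assms] by (auto simp: is_norm_def)
  then show "0 \<le> modulus N z" "modulus N z = 0 \<longleftrightarrow> fst z \<le> 0 \<and> snd z = 0"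
    by (auto simp: modulus_def max_def)
qed

section \<open>Optimal precision and oracle predictors\<close>

theorem corollaryC1:
  fixes M :: "'w measure"
    and Y :: "'w \<Rightarrow> real" and X :: "'w \<Rightarrow> real ^ 'd"
    and N :: "real ^ 'd \<Rightarrow> real"
    and p r :: nat
    and b :: "nat \<Rightarrow> real" and a :: "nat \<Rightarrow> real ^ 'd"
  assumes "prob_space M"
    and "is_norm N"
    and "CARD('d) \<ge> 2"
    and "\<And>i. i \<in> {1..p} \<Longrightarrow> b i \<ge> 0"
    and "\<exists>i\<in>{1..p}. b i \<noteq> 0"
    and "\<exists>i\<in>{1..p}. a i \<noteq> 0"
    and "RV1 M (\<lambda>\<omega>. (Y \<omega>, X \<omega>)) ({0..} \<times> UNIV) (\<lambda>n. real n)
           (\<Sum>i=1..p. modulus N (b i, a i)) (modulus N)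
           (discrete_angular_measure (modulus N) p (\<lambda>i. (b i, a i)))"
    and "r \<le> p"
    and "\<And>i. i \<in> {1..r} \<Longrightarrow> a i \<noteq> 0"
    and "\<And>i. i \<in> {r+1..p} \<Longrightarrow> a i = 0"
    and "\<And>i j. i \<in> {1..r} \<Longrightarrow> j \<in> {1..r} \<Longrightarrow> i \<noteq> j \<Longrightarrow> a i /\<^sub>R N (a i) \<noteq> a j /\<^sub>R N (a j)"
  shows "optimal_precision M Y X = ereal ((\<Sum>i=1..r. b i) / (\<Sum>i=1..p. b i)) \<and>
    (optimal_precision M Y X > 0 \<longleftrightarrow> (\<Sum>i=1..r. b i) > 0) \<and>
    (optimal_precision M Y X > 0 \<longrightarrow>
       (\<exists>h. oracle_predictor p r b a h) \<and>
       (\<forall>h. oracle_predictor p r b a h \<longrightarrow>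
          h \<in> predictors M Y X \<and>
          ((\<lambda>q. ereal (precision M Y (\<lambda>\<omega>. h (X \<omega>)) q)) \<longlongrightarrow> optimal_precision M Y X) (at_left 1)))"
proof -
  interpret prob_space M by fact
  note N = \<open>is_norm N\<close>
  let ?\<tau> = "modulus N"
  let ?c = "\<lambda>i. (b i, a i)"
  let ?\<sigma> = "discrete_angular_measure ?\<tau> p ?c"
  note RV = \<open>RV1 M _ _ _ _ _ _\<close>
  have b_nn: "0 \<le> b i" if "i \<in> {1..p}" for i using assms(4) that .
  define B where "B = (\<Sum>i=1..p. b i)"
  define R where "R = (\<Sum>i=1..r. b i)"
  have "B > 0"
  proof -
    obtain i where "i \<in> {1..p}" "b i \<noteq> 0" using assms(5) by blast
    with b_nn show ?thesis unfolding B_def by (intro sum_pos2[of _ i]) (auto simp: less_le)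
  qed
  have "0 \<le> R" unfolding R_def using b_nn \<open>r \<le> p\<close> by (intro sum_nonneg) auto
  have c_pos: "0 < (\<Sum>i=1..p. ?\<tau> (?c i))"
  proof -
    have "B \<le> (\<Sum>i=1..p. ?\<tau> (?c i))"
      unfolding B_def by (intro sum_mono) (simp add: modulus_def is_norm_nonneg[OF N] add_increasing2)
    with \<open>B > 0\<close> show ?thesis by simp
  qed
  \<comment> \<open>The constant of regular variation cancels the normalisation of the angular
    measure, which leaves a plain sum over the atoms.\<close>
  have tail: "((\<lambda>t. t * \<P>(\<omega> in M. f (Y \<omega>, X \<omega>) > t)) \<longlongrightarrow> (\<Sum>i=1..p. f (?c i))) at_top"
    if f: "continuous_on UNIV f" "homogeneous1 f" "\<And>z. 0 \<le> f z" "\<And>z. f z \<le> C * ?\<tau> z" for f C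
  proof -
    have "(\<Sum>i=1..p. ?\<tau> (?c i)) * integral\<^sup>L ?\<sigma> f = (\<Sum>i=1..p. f (?c i))"
    proof (rule integral_discrete_angular_measure)
      show "f \<in> borel_measurable borel" using f(1) by (rule borel_measurable_continuous_onI)
      show "?c i = 0" if "i \<in> {1..p}" "?\<tau> (?c i) = 0" for i
        using that b_nn[of i] by (simp add: modulus_is_norm(3)[OF N] zero_prod_def)
    qed (use f(2) c_pos modulus_is_norm(2)[OF N] in auto)
    with tendsto_tail_homogeneous[OF RV modulus_is_norm(1,2)[OF N] f] show ?thesis by simp
  qed
  have XY: "(\<lambda>\<omega>. (Y \<omega>, X \<omega>)) \<in> borel_measurable M" and Y_nn: "\<And>\<omega>. \<omega> \<in> space M \<Longrightarrow> 0 \<le> Y \<omega>"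
    using RV by (auto simp: RV1_def)
  from XY have [measurable]: "Y \<in> borel_measurable M" "X \<in> borel_measurable M"
    by (auto simp flip: borel_prod dest: measurable_compose[OF _ measurable_fst] measurable_compose[OF _ measurable_snd])
  have Y_tail: "((\<lambda>t. t * \<P>(\<omega> in M. Y \<omega> > t)) \<longlongrightarrow> B) at_top"
  proof -
    \<comment> \<open>The positive part makes the function nonnegative on the whole product space,
      as \<open>tail\<close> demands; on the range of \<open>Y\<close> it changes nothing.\<close>
    have "((\<lambda>t. t * \<P>(\<omega> in M. max 0 (fst (Y \<omega>, X \<omega>)) > t)) \<longlongrightarrow> (\<Sum>i=1..p. max 0 (fst (?c i)))) at_top"
      by (rule tail[of _ 1])
        (auto simp: homogeneous1_def max_mult_distrib_left modulus_def is_norm_nonneg[OF N] intro!: continuous_intros)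
    then show ?thesis using b_nn by (simp add: B_def Y_nn cong: conj_cong)
  qed
  have predictor: "(asymptotically_calibrated M Y (\<lambda>\<omega>. g (X \<omega>)) \<longleftrightarrow> (\<Sum>i=1..r. g (a i)) = B) \<and>
      (asymptotically_calibrated M Y (\<lambda>\<omega>. g (X \<omega>)) \<longrightarrow>
        (precision M Y (\<lambda>\<omega>. g (X \<omega>)) \<longlongrightarrow> (\<Sum>i=1..r. min (b i) (g (a i))) / B) (at_left 1))"
    if g: "continuous_on UNIV g" "\<And>x. 0 \<le> g x" "homogeneous1 g" for g
  proof -
    have [measurable]: "g \<in> borel_measurable borel" by (rule borel_measurable_continuous_onI[OF g(1)])
    have "g (0 *\<^sub>R 0) = 0 * g 0" using g(3) unfolding homogeneous1_def by blast
    then have "g 0 = 0" by simp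
    obtain C where C: "0 \<le> C" "\<And>x. g x \<le> C * N x" using homogeneous1_le_norm[OF N g(1,3)] by blast
    have cont: "continuous_on UNIV (\<lambda>z :: real \<times> (real ^ 'd). g (snd z))"
      by (rule continuous_on_compose2[OF g(1)]) (auto intro: continuous_intros)
    have bound: "g (snd z) \<le> C * ?\<tau> z" for z
    proof -
      have "C * N (snd z) \<le> C * ?\<tau> z" using C(1) by (intro mult_left_mono) (auto simp: modulus_def)
      with C(2)[of "snd z"] show ?thesis by simp
    qed
    \<comment> \<open>Atoms with \<open>i > r\<close> have \<open>a i = 0\<close>, where
      \<open>g\<close> vanishes, so they drop out of the sums for \<open>g\<close> and for the
      minimum.\<close>
    have restrict: "(\<Sum>i=1..p. k i) = (\<Sum>i=1..r. k i)" if "\<And>i. i \<in> {r+1..p} \<Longrightarrow> k i = 0" for k :: "nat \<Rightarrow> real"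
      using that \<open>r \<le> p\<close> by (intro sum.mono_neutral_right) auto
    have "((\<lambda>t. t * \<P>(\<omega> in M. g (snd (Y \<omega>, X \<omega>)) > t)) \<longlongrightarrow> (\<Sum>i=1..p. g (snd (?c i)))) at_top"
      using g cont bound by (intro tail) (auto simp: homogeneous1_def)
    also have "(\<Sum>i=1..p. g (snd (?c i))) = (\<Sum>i=1..r. g (a i))"
      using assms(10) \<open>g 0 = 0\<close> by (subst restrict) auto
    finally have g_tail: "((\<lambda>t. t * \<P>(\<omega> in M. g (X \<omega>) > t)) \<longlongrightarrow> (\<Sum>i=1..r. g (a i))) at_top" by simp
    let ?m = "\<lambda>z. min (max 0 (fst z)) (g (snd z))"
    have "((\<lambda>t. t * \<P>(\<omega> in M. ?m (Y \<omega>, X \<omega>) > t)) \<longlongrightarrow> (\<Sum>i=1..p. ?m (?c i))) at_top"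
    proof (rule tail)
      show "continuous_on UNIV ?m" by (intro continuous_intros cont)
      show "homogeneous1 ?m"
        using g(3) by (auto simp: homogeneous1_def min_mult_distrib_left max_mult_distrib_left)
      show "0 \<le> ?m z" for z using g(2) by simp
      show "?m z \<le> C * ?\<tau> z" for z using bound[of z] by simp
    qed
    also have "(\<Sum>i=1..p. ?m (?c i)) = (\<Sum>i=1..p. min (b i) (g (a i)))"
      using b_nn by (intro sum.cong) auto
    also have "\<dots> = (\<Sum>i=1..r. min (b i) (g (a i)))"
      using assms(10) \<open>g 0 = 0\<close> \<open>r \<le> p\<close> b_nn by (intro restrict) auto
    finally have m_tail: "((\<lambda>t. t * \<P>(\<omega> in M. min (Y \<omega>) (g (X \<omega>)) > t)) \<longlongrightarrow>
        (\<Sum>i=1..r. min (b i) (g (a i)))) at_top"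
      by (simp add: Y_nn cong: conj_cong)
    have calibrated: "asymptotically_calibrated M Y (\<lambda>\<omega>. g (X \<omega>)) \<longleftrightarrow> (\<Sum>i=1..r. g (a i)) = B"
      using Y_tail g_tail \<open>B > 0\<close> by (rule asymptotically_calibrated_iff)
    moreover have "(precision M Y (\<lambda>\<omega>. g (X \<omega>)) \<longlongrightarrow> (\<Sum>i=1..r. min (b i) (g (a i))) / B) (at_left 1)"
      if "(\<Sum>i=1..r. g (a i)) = B"
      using that Y_tail g_tail m_tail \<open>B > 0\<close> by (intro tendsto_precision) auto
    ultimately show ?thesis by blast
  qed
  have le: "Limsup (at_left 1) (\<lambda>q. ereal (precision M Y (\<lambda>\<omega>. g (X \<omega>)) q)) \<le> ereal (R / B)"
    if "g \<in> predictors M Y X" for g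
  proof -
    have "(precision M Y (\<lambda>\<omega>. g (X \<omega>)) \<longlongrightarrow> (\<Sum>i=1..r. min (b i) (g (a i))) / B) (at_left 1)"
      using that predictor[of g] by (simp add: predictors_def)
    then have "Limsup (at_left 1) (\<lambda>q. ereal (precision M Y (\<lambda>\<omega>. g (X \<omega>)) q))
        = ereal ((\<Sum>i=1..r. min (b i) (g (a i))) / B)"
      by (intro lim_imp_Limsup) auto
    also have "\<dots> \<le> ereal (R / B)"
      unfolding R_def using \<open>B > 0\<close> by (auto intro!: divide_right_mono sum_mono)
    finally show ?thesis .
  qed
  \<comment> \<open>Since \<open>R / B\<close> bounds every limit superior, one predictor reaching
    it determines the supremum.\<close>
  have attained: "optimal_precision M Y X = ereal (R / B)"
    if "g \<in> predictors M Y X" "(precision M Y (\<lambda>\<omega>. g (X \<omega>)) \<longlongrightarrow> R / B) (at_left 1)" for g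
  proof (rule antisym)
    show "optimal_precision M Y X \<le> ereal (R / B)"
      unfolding optimal_precision_def by (rule SUP_least) (rule le)
    have "Limsup (at_left 1) (\<lambda>q. ereal (precision M Y (\<lambda>\<omega>. g (X \<omega>)) q)) = ereal (R / B)"
      using that(2) by (intro lim_imp_Limsup) auto
    then show "ereal (R / B) \<le> optimal_precision M Y X"
      unfolding optimal_precision_def using SUP_upper[OF that(1)] by metis
  qed
  have optimal: "h \<in> predictors M Y X \<and> (precision M Y (\<lambda>\<omega>. h (X \<omega>)) \<longlongrightarrow> R / B) (at_left 1)"
    if "R > 0" and h: "oracle_predictor p r b a h" for h
  proof -
    have h': "continuous_on UNIV h" "\<And>x. 0 \<le> h x" "homogeneous1 h"
      using h by (auto simp: oracle_predictor_def)
    have ha: "h (a i) = B / R * b i" if "i \<in> {1..r}" for i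
      using h that by (auto simp: oracle_predictor_def B_def R_def)
    have "(\<Sum>i=1..r. h (a i)) = B / R * R"
      unfolding R_def sum_distrib_left using ha by (intro sum.cong) (auto simp: R_def)
    then have sum: "(\<Sum>i=1..r. h (a i)) = B" using \<open>R > 0\<close> by simp
    have "R \<le> B" unfolding R_def B_def using b_nn \<open>r \<le> p\<close> by (intro sum_mono2) auto
    have "min (b i) (h (a i)) = b i" if "i \<in> {1..r}" for i
    proof -
      \<comment> \<open>The factor \<open>B / R\<close> is at least 1, so \<open>h (a i)\<close>
        dominates \<open>b i\<close> and the minimum is \<open>b i\<close>, while the same factor
        makes the values sum to \<open>B\<close>.\<close>
      have "1 * b i \<le> B / R * b i"
        using \<open>R \<le> B\<close> \<open>R > 0\<close> b_nn[of i] that \<open>r \<le> p\<close> by (intro mult_right_mono) auto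
      with ha[OF that] show ?thesis by simp
    qed
    then have "(\<Sum>i=1..r. min (b i) (h (a i))) = R" unfolding R_def by (intro sum.cong) auto
    then show ?thesis using predictor[OF h'] sum h' by (simp add: predictors_def)
  qed
  have exists_h: "\<exists>h. oracle_predictor p r b a h"
  proof -
    obtain h where "continuous_on UNIV h" "\<And>x. 0 \<le> h x" "homogeneous1 h"
      "\<And>i. i \<in> {1..r} \<Longrightarrow> h (a i) = B / R * b i"
    proof (rule exists_homogeneous1_interpolation[OF N, of "{1..r}" a "\<lambda>i. B / R * b i"])
      \<comment> \<open>For \<open>R = 0\<close> the quotient is 0 by convention, so the prescribed
        values are nonnegative in that case too.\<close>
      show "0 \<le> B / R * b i" if "i \<in> {1..r}" for i
        using \<open>B > 0\<close> \<open>0 \<le> R\<close> b_nn[of i] that \<open>r \<le> p\<close> by auto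
    qed (use assms(9,11) in auto)
    then show ?thesis by (auto simp: oracle_predictor_def B_def R_def)
  qed
  have opt: "optimal_precision M Y X = ereal (R / B)"
  proof (cases "R > 0")
    case True
    with optimal exists_h attained show ?thesis by blast
  next
    case False
    with \<open>0 \<le> R\<close> have "R = 0" by simp
    then have b0: "b i = 0" if "i \<in> {1..r}" for i
      using that b_nn \<open>r \<le> p\<close> unfolding R_def by (subst (asm) sum_nonneg_eq_0_iff) auto
    have norm: "N 0 = 0" "N x > 0" if "x \<noteq> 0" for x
      using N is_norm_nonneg[OF N, of x] that by (auto simp: is_norm_def less_le)
    \<comment> \<open>A nonzero \<open>a i\<close> must have \<open>i \<le> r\<close>, which makes
      the normalising sum of norms positive.\<close>
    obtain i where "i \<in> {1..p}" "a i \<noteq> 0" using assms(6) by blast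
    moreover from this have "i \<in> {1..r}" using assms(10)[of i] by (cases "i \<le> r") auto
    ultimately have S: "0 < (\<Sum>i=1..r. N (a i))"
      using norm by (intro sum_pos2[of _ i]) (auto simp: is_norm_nonneg[OF N])
    \<comment> \<open>The factor is chosen so that the values at \<open>a 1, ..., a r\<close> sum to
      \<open>B\<close>, which is calibration.\<close>
    define g where "g x = B / (\<Sum>i=1..r. N (a i)) * N x" for x
    have g: "continuous_on UNIV g" "\<And>x. 0 \<le> g x" "homogeneous1 g"
    proof -
      show "continuous_on UNIV g" unfolding g_def by (intro continuous_intros is_norm_continuous_on[OF N])
      show "0 \<le> g x" for x unfolding g_def using S \<open>B > 0\<close> is_norm_nonneg[OF N, of x] by auto
      show "homogeneous1 g" using N by (auto simp: g_def homogeneous1_def is_norm_def)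
    qed
    have "(\<Sum>i=1..r. g (a i)) = B" unfolding g_def sum_distrib_left[symmetric] using S by simp
    moreover have "(\<Sum>i=1..r. min (b i) (g (a i))) = R"
      unfolding \<open>R = 0\<close> using b0 g(2) by (intro sum.neutral) auto
    ultimately show ?thesis using predictor[OF g] g by (intro attained[of g]) (auto simp: predictors_def)
  qed
  have "0 < R / B \<longleftrightarrow> 0 < R" using \<open>B > 0\<close> by (simp add: zero_less_divide_iff)
  then show ?thesis
    using optimal exists_h unfolding opt R_def[symmetric] B_def[symmetric] by auto
qed

end
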